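(* Let $b > i \ge 0$ be two integers and let $n \ge b$. Let $([n],R)$ be a set system (with $[n]=\{1,\dots,n\}$ and $R$ a set of subsets of $[n]$) such that $f_R(b) < \upsilon_i(b)$, where $\upsilon_i(b) = 2^i(b-i+1)$. Then \[ |R| = f_R(n) < \sum_{j=0}^{i} (b-j+1)\binom{n}{j}. \]
   Context: For a set system $([n],R)$ and $X\subseteq[n]$, the trace of $R$ on $X$ is $R_{|X}=\{A\cap X \mid A\in R\}$. The shatter function is $f_R(b)=\max_{X\subseteq[n],\,|X|=b} |R_{|X}|$ for $0\le b\le n$. Convention: $\binom{n}{-1}=0$. *)

theory Defs
  imports Complex_Main
begin

definition trace :: "nat set set \<Rightarrow> nat set \<Rightarrow> nat set set" where
  "trace R X = {A \<inter> X | A. A \<in> R}"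

text \<open>
  The maximum is meaningful only for a finite family \<open>R\<close> and \<open>b \<le> n\<close>, where it ranges
  over a finite nonempty set of numbers.
\<close>

definition shatter_function :: "nat \<Rightarrow> nat set set \<Rightarrow> nat \<Rightarrow> nat" where
  "shatter_function n R b = Max {card (trace R X) | X. X \<subseteq> {1..n} \<and> card X = b}"

text \<open>Natural-number subtraction is exact here, because this is only used for \<open>i < b\<close>.\<close>

definition upsilon :: "nat \<Rightarrow> nat \<Rightarrow> nat" where
  "upsilon i b = 2 ^ i * (b - i + 1)"

end

(*
  Double induction in the style of Sauer's lemma. Deleting an element x splits R into its trace
  on the remaining ground set and the link D of the sets A such that both A and insert x A are
  in R. A trace of D on b - 1 elements yields twice as many traces of R on b elements, so D
  satisfies the hypothesis for (i - 1, b - 1), and the two bounds add up by Pascal's rule. The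
  case i = 0 is Bondy's theorem.
*)
theory Submission
  imports Defs
begin

lemma trace_eq_image: "trace R X = (\<lambda>A. A \<inter> X) ` R"
  by (auto simp: trace_def)

lemma finite_trace: "finite X \<Longrightarrow> finite (trace R X)"
  by (rule finite_subset[of _ "Pow X"]) (auto simp: trace_def)

lemma trace_self: "R \<subseteq> Pow V \<Longrightarrow> trace R V = R"
  by (simp add: trace_eq_image subset_iff Int_absorb2 cong: image_cong)

lemma trace_trace: "X \<subseteq> Y \<Longrightarrow> trace (trace R Y) X = trace R X"
  unfolding trace_eq_image image_image by (rule image_cong) auto

lemma card_trace_mono:
  assumes "X \<subseteq> Y" "finite Y"
  shows "card (trace R X) \<le> card (trace R Y)"
  using card_image_le[OF finite_trace[OF assms(2)], of "\<lambda>A. A \<inter> X" R] trace_trace[OF assms(1), of R]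
  by (simp add: trace_eq_image)

text \<open>Intersecting with \<open>X\<close> maps \<open>trace R Y\<close> onto
  \<open>trace R X\<close>, and \<open>A\<close>, \<open>B\<close> show that this map is not
  injective, so at least one trace is lost.\<close>

lemma card_trace_less:
  assumes "X \<subseteq> Y" "finite Y" and A: "A \<in> R" and B: "B \<in> R"
    and "A \<inter> X = B \<inter> X" "A \<inter> Y \<noteq> B \<inter> Y"
  shows "card (trace R X) < card (trace R Y)"
proof -
  have "A \<inter> Y \<inter> X = B \<inter> Y \<inter> X"
    using assms(1,5) by blast
  moreover have "A \<inter> Y \<in> trace R Y" "B \<inter> Y \<in> trace R Y"
    using A B by (simp_all add: trace_eq_image)
  ultimately have "\<not> inj_on (\<lambda>C. C \<inter> X) (trace R Y)"
    using assms(6) by (meson inj_onD)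
  then have "card (trace (trace R Y) X) \<noteq> card (trace R Y)"
    using eq_card_imp_inj_on[OF finite_trace[OF assms(2), of R], of "\<lambda>C. C \<inter> X"]
    by (auto simp: trace_eq_image[of _ X])
  then show ?thesis
    using card_trace_mono[OF assms(1,2), of R] by (simp add: trace_trace[OF assms(1)])
qed

text \<open>Bondy's theorem, by growing \<open>X\<close> one element at a time while keeping more
  traces than elements.\<close>

lemma bondy:
  assumes V: "finite V" and R: "R \<subseteq> Pow V" and "k \<le> card V" and "k < card R"
  obtains X where "X \<subseteq> V" "card X = k" "k < card (trace R X)"
proof -
  have "\<exists>X\<subseteq>V. card X = k \<and> k < card (trace R X)"
    using assms(3,4)
  proof (induction k)
    case 0
    then have "R \<noteq> {}" by auto
    then show ?case
      by (intro exI[of _ "{}"]) (simp add: trace_eq_image image_constant_conv)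
  next
    case (Suc k)
    then obtain X where X: "X \<subseteq> V" "card X = k" "k < card (trace R X)"
      by auto
    have fX: "finite X"
      using X V finite_subset by auto
    show ?case
    proof (cases "Suc k < card (trace R X)")
      \<comment> \<open>There are traces to spare, so by monotonicity any new element will
        do.\<close>
      case True
      have "X \<noteq> V"
        using X Suc.prems by auto
      then obtain x where x: "x \<in> V" "x \<notin> X"
        using X by auto
      have "card (trace R X) \<le> card (trace R (insert x X))"
        using fX by (intro card_trace_mono) auto
      then show ?thesis
        using True X x fX by (intro exI[of _ "insert x X"]) simp
    next
      case False
      \<comment> \<open>\<open>R\<close> has more members than traces on \<open>X\<close>, so two
        members agree on \<open>X\<close>. Adding an element on which they differ separates them and
        gains a trace.\<close>
      have "\<not> inj_on (\<lambda>A. A \<inter> X) R"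
        using card_image[of "\<lambda>A. A \<inter> X" R] False Suc.prems by (auto simp: trace_eq_image)
      then obtain A B where AB: "A \<in> R" "B \<in> R" "A \<inter> X = B \<inter> X" "A \<noteq> B"
        by (auto simp: inj_on_def)
      then obtain x where x: "x \<in> A \<longleftrightarrow> x \<notin> B"
        by auto
      have "card (trace R X) < card (trace R (insert x X))"
        using x fX AB by (intro card_trace_less[of _ _ A _ B]) auto
      moreover have "x \<in> V" "x \<notin> X"
        using x AB R by auto
      ultimately show ?thesis
        using X fX by (intro exI[of _ "insert x X"]) simp
    qed
  qed
  then show ?thesis
    using that by blast
qed

text \<open>Deleting \<open>x\<close> is injective on the members that avoid \<open>x\<close> and on
  those that contain it. The two images cover the trace on \<open>F\<close> and overlap exactly in
  the link, so inclusion-exclusion gives the count.\<close>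

lemma card_trace_link:
  assumes "finite R" and "R \<subseteq> Pow (insert x F)" and "x \<notin> F"
  shows "card R = card (trace R F) + card {A \<in> R. x \<notin> A \<and> insert x A \<in> R}"
proof -
  let ?R0 = "{A \<in> R. x \<notin> A}" and ?R1 = "{A \<in> R. x \<in> A}"
  let ?S = "(\<lambda>A. A - {x}) ` ?R1"
  have F: "A \<inter> F = A - {x}" if "A \<in> R" for A
    using that assms(2,3) by blast
  have "trace R F = (\<lambda>A. A - {x}) ` R"
    unfolding trace_eq_image by (rule image_cong) (simp_all add: F)
  also have "\<dots> = (\<lambda>A. A - {x}) ` ?R0 \<union> ?S"
    by blast
  also have "(\<lambda>A. A - {x}) ` ?R0 = ?R0"
    by simp
  finally have "trace R F = ?R0 \<union> ?S" .
  moreover have "{A \<in> R. x \<notin> A \<and> insert x A \<in> R} = ?R0 \<inter> ?S"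
  proof (intro set_eqI iffI)
    fix A assume "A \<in> {A \<in> R. x \<notin> A \<and> insert x A \<in> R}"
    then have "A \<in> ?R0" "insert x A \<in> ?R1" "A = insert x A - {x}"
      by auto
    then show "A \<in> ?R0 \<inter> ?S"
      by blast
  qed (auto simp: insert_absorb)
  moreover have "card ?R0 + card ?S = card (?R0 \<union> ?S) + card (?R0 \<inter> ?S)"
    using assms(1) by (intro card_Un_Int) auto
  moreover have "card ?S = card ?R1"
    by (intro card_image inj_onI) (metis insert_Diff mem_Collect_eq)
  moreover have "card R = card ?R0 + card ?R1"
  proof -
    have "card (?R0 \<union> ?R1) = card ?R0 + card ?R1"
      using assms(1) by (intro card_Un_disjoint) auto
    moreover have "?R0 \<union> ?R1 = R"
      by blast
    ultimately show ?thesis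
      by simp
  qed
  ultimately show ?thesis
    by simp
qed

text \<open>A trace \<open>B\<close> of the link on \<open>Y\<close> comes from a pair
  \<open>A\<close>, \<open>insert x A\<close> in \<open>R\<close>, whose traces on
  \<open>insert x Y\<close> are \<open>B\<close> and \<open>insert x B\<close>.\<close>

lemma card_trace_link_le:
  assumes "finite Y" and "x \<notin> Y"
  shows "2 * card (trace {A \<in> R. x \<notin> A \<and> insert x A \<in> R} Y) \<le> card (trace R (insert x Y))"
    (is "2 * card ?T \<le> _")
proof -
  have x: "x \<notin> B" if "B \<in> ?T" for B
    using that assms(2) by (auto simp: trace_eq_image)
  have "2 * card ?T = card ?T + card (insert x ` ?T)"
    using x by (subst card_image) (simp_all add: inj_on_def insert_ident)
  also have "\<dots> = card (?T \<union> insert x ` ?T)"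
    using x assms by (subst card_Un_disjoint) (auto simp: finite_trace)
  also have "\<dots> \<le> card (trace R (insert x Y))"
  proof (rule card_mono)
    show "finite (trace R (insert x Y))"
      using assms by (simp add: finite_trace)
    have "A \<inter> Y \<in> trace R (insert x Y)" "insert x (A \<inter> Y) \<in> trace R (insert x Y)"
      if "A \<in> R" "x \<notin> A" "insert x A \<in> R" for A
    proof -
      have "A \<inter> Y = A \<inter> insert x Y" "insert x (A \<inter> Y) = insert x A \<inter> insert x Y"
        using that(2) by auto
      then show "A \<inter> Y \<in> trace R (insert x Y)" "insert x (A \<inter> Y) \<in> trace R (insert x Y)"
        using that by (auto simp only: trace_eq_image)
    qed
    then show "?T \<union> insert x ` ?T \<subseteq> trace R (insert x Y)"
      unfolding trace_eq_image[of _ Y] by blast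
  qed
  finally show ?thesis .
qed

definition trace_bound :: "nat \<Rightarrow> nat \<Rightarrow> nat \<Rightarrow> nat" where
  "trace_bound b i n = (\<Sum>j\<le>i. (b - j + 1) * (n choose j))"

text \<open>Pascal's rule term by term: the coefficient \<open>b - j + 1\<close> does not change
  when \<open>b\<close> and \<open>j\<close> grow together. The summands are the bounds for the
  trace and for the link.\<close>

lemma trace_bound_Suc:
  "trace_bound (Suc b) (Suc i) (Suc n) = trace_bound (Suc b) (Suc i) n + trace_bound b i n"
  unfolding trace_bound_def sum.atMost_Suc_shift binomial_Suc_Suc
  by (simp add: sum.distrib algebra_simps)

text \<open>The factor 2 matches the doubling in \<open>card_trace_link_le\<close>.\<close>

lemma upsilon_Suc: "upsilon (Suc i) (Suc b) = 2 * upsilon i b"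
  by (simp add: upsilon_def)

lemma trace_bound_mono: "b \<le> b' \<Longrightarrow> i \<le> i' \<Longrightarrow> trace_bound b i n \<le> trace_bound b' i' n"
  unfolding trace_bound_def
  by (rule order_trans[OF sum_mono[of "{..i}"] sum_mono2]) auto

text \<open>Settles ground sets of size exactly \<open>b\<close>. In the induction
  \<open>upsilon\<close> doubles, while \<open>trace_bound\<close> splits into two summands, each at
  least the previous bound.\<close>

lemma upsilon_le_trace_bound: "i \<le> b \<Longrightarrow> upsilon i b \<le> trace_bound b i b"
proof (induction i arbitrary: b)
  case 0
  then show ?case by (simp add: upsilon_def trace_bound_def)
next
  case (Suc i)
  then obtain c where b: "b = Suc c" "i \<le> c"
    by (cases b) auto
  then show ?case
    using Suc.IH[of c] trace_bound_mono[of c "Suc c" i "Suc i" c]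
    by (simp add: upsilon_Suc trace_bound_Suc)
qed

text \<open>The ground set is an arbitrary finite \<open>V\<close>, since deleting an element of an
  interval need not leave an interval; \<open>i\<close> and \<open>b\<close> vary because both drop
  for the link.\<close>

lemma card_less_trace_bound:
  assumes "finite V" and "R \<subseteq> Pow V" and "i < b" and "b \<le> card V"
    and "\<And>X. X \<subseteq> V \<Longrightarrow> card X = b \<Longrightarrow> card (trace R X) < upsilon i b"
  shows "card R < trace_bound b i (card V)"
  using assms
proof (induction V arbitrary: R i b rule: finite_induct)
  case empty
  then show ?case by simp
next
  case (insert x F)
  have "finite R"
    using insert.hyps insert.prems(1) by (auto intro: finite_subset)
  consider "b = card (insert x F)" | "b \<le> card F" "i = 0" | j c where "b \<le> card F" "i = Suc j" "b = Suc c"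
    using insert.prems(2,3) insert.hyps by (cases i; cases b) (auto simp: le_Suc_eq)
  then show ?case
  proof cases
    case 1
    then have "card R < upsilon i b"
      using insert.prems(4)[of "insert x F"] trace_self[OF insert.prems(1)] by simp
    then show ?thesis
      using upsilon_le_trace_bound[of i b] insert.prems(2) 1 by simp
  next
    case 2
    \<comment> \<open>For \<open>i = 0\<close> both \<open>upsilon i b\<close> and the bound equal
      \<open>b + 1\<close>, so Bondy's theorem would yield a \<open>b\<close>-set with too many
      traces.\<close>
    have "\<not> b < card R"
    proof
      assume "b < card R"
      then obtain X where "X \<subseteq> insert x F" "card X = b" "b < card (trace R X)"
        using bondy[of "insert x F" R b] insert by auto
      then show False
        using insert.prems(4)[of X] 2 by (simp add: upsilon_def)
    qed
    then show ?thesis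
      using 2 by (simp add: trace_bound_def)
  next
    case 3
    let ?D = "{A \<in> R. x \<notin> A \<and> insert x A \<in> R}"
    have "card (trace R F) < trace_bound b i (card F)"
    proof (rule insert.IH)
      show "trace R F \<subseteq> Pow F"
        by (auto simp: trace_def)
      show "card (trace (trace R F) X) < upsilon i b" if "X \<subseteq> F" "card X = b" for X
        using insert.prems(4)[of X] that by (auto simp: trace_trace)
    qed (use insert.prems 3 in auto)
    \<comment> \<open>The size drops to \<open>c = b - 1\<close> because \<open>x\<close> is put
      back into \<open>Y\<close> before the hypothesis on \<open>R\<close> is used.\<close>
    moreover have "card ?D < trace_bound c j (card F)"
    proof (rule insert.IH)
      fix Y assume Y: "Y \<subseteq> F" "card Y = c"
      then have f: "finite Y" "x \<notin> Y"
        using insert.hyps finite_subset by auto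
      then have "card (trace R (insert x Y)) < upsilon i b"
        using Y 3 by (intro insert.prems) auto
      then show "card (trace ?D Y) < upsilon j c"
        using card_trace_link_le[OF f, of R] 3 by (simp add: upsilon_Suc)
    qed (use insert.prems 3 in auto)
    ultimately show ?thesis
      using card_trace_link[OF \<open>finite R\<close> insert.prems(1) insert.hyps(2)] insert.hyps insert.prems(2) 3
      by (simp add: trace_bound_Suc)
  qed
qed

lemma card_trace_le_shatter_function:
  assumes "X \<subseteq> {1..n}"
  shows "card (trace R X) \<le> shatter_function n R (card X)"
  unfolding shatter_function_def using assms by (intro Max_ge) auto

lemma shatter_function_top:
  assumes "R \<subseteq> Pow {1..n}"
  shows "shatter_function n R n = card R"
proof -
  have "X \<subseteq> {1..n} \<and> card X = n \<longleftrightarrow> X = {1..n}" for X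
    using card_subset_eq[of "{1..n}" X] by auto
  then show ?thesis
    using trace_self[OF assms] by (simp add: shatter_function_def)
qed

theorem theorem1:
  fixes b i n :: nat and R :: "nat set set"
  assumes "i < b" and "b \<le> n"
    and "R \<subseteq> Pow {1..n}"
    and "shatter_function n R b < upsilon i b"
  shows "card R = shatter_function n R n \<and>
         shatter_function n R n < (\<Sum>j = 0..i. (b - j + 1) * (n choose j))"
proof -
  \<comment> \<open>A bound on the maximum bounds the number of traces on every
    \<open>b\<close>-subset of \<open>{1..n}\<close>.\<close>
  have "card R < trace_bound b i (card {1..n})"
    using assms card_trace_le_shatter_function[of _ n R]
    by (intro card_less_trace_bound) (auto intro: le_less_trans)
  then show ?thesis
    by (simp add: shatter_function_top[OF assms(3)] trace_bound_def atMost_atLeast0)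
qed

end
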